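(* Let $L$ be a semiprime Lie ideal in a $C^*$-algebra $A$, let $I_{\mathrm{min}}$ denote the two-sided ideal in $A$ generated by $[A,L]$, and let $I_{\mathrm{max}}$ denote the largest two-sided ideal in $A$ that is contained in $L$. Then \[ L = T(I_{\mathrm{min}}) = T(I_{\mathrm{max}}). \] Further, a two-sided ideal $I\subseteq A$ satisfies $L=T(I)$ if and only if $I_{\mathrm{min}}\subseteq I\subseteq I_{\mathrm{max}}$. The two-sided ideal $I_{\mathrm{max}}$ is semiprime. Moreover, a Lie ideal in $A$ is semiprime if and only if it has the form $T(J)$ for a semiprime two-sided ideal $J$ in $A$.
   Context: A $C^*$-algebra $A$ need not be unital. For $a,b\in A$ put $[a,b]:=ab-ba$; for subsets $E,F\subseteq A$, $[E,F]$ denotes the linear span of $\{[a,b]:a\in E,b\in F\}$. A two-sided ideal in $A$ is a linear subspace $I\subseteq A$ (not necessarily closed) with $ax,xa\in I$ for all $a\in A$, $x\in I$; the two-sided ideal generated by a subset is the smallest such ideal containing it (no closure is taken). Every linear subspace of $A$ contains a unique largest two-sided ideal of $A$. A two-sided ideal $I$ is semiprime if for every two-sided ideal $J$, $J^2\subseteq I$ implies $J\subseteq I$ (equivalently, $I$ is an intersection of prime ideals, with $A$ itself being the empty intersection). A Lie ideal in $A$ is a linear subspace $L\subseteq A$ (not necessarily closed) with $[A,L]\subseteq L$. A Lie ideal $L$ is semiprime if for every Lie ideal $K\subseteq A$ with $[K,K]\subseteq L$ one has $K\subseteq L$. For a linear subspace $L\subseteq A$, the full normalizer subspace is $T(L):=\{a\in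 A:[A,a]\subseteq L\}$. *)

theory Defs
  imports "HOL-Analysis.Analysis"
begin

text \<open>
  (Complex) C*-algebras, not necessarily unital, possibly zero.  The underlying real Banach algebra
  comes from the library classes; \<open>scaleR_scaleC\<close> makes its real scalar multiplication the
  restriction of the complex one.
\<close>

class cstar_algebra = real_normed_algebra + banach +
  fixes scaleC :: "complex \<Rightarrow> 'a \<Rightarrow> 'a"  (infixr \<open>*\<^sub>C\<close> 75)
    and star :: "'a \<Rightarrow> 'a"
  assumes scaleC_add_right: "c *\<^sub>C (x + y) = c *\<^sub>C x + c *\<^sub>C y"
    and scaleC_add_left: "(c + d) *\<^sub>C x = c *\<^sub>C x + d *\<^sub>C x"
    and scaleC_scaleC: "c *\<^sub>C d *\<^sub>C x = (c * d) *\<^sub>C x"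
    and scaleR_scaleC: "scaleR r x = complex_of_real r *\<^sub>C x"
    and mult_scaleC_left: "(c *\<^sub>C x) * y = c *\<^sub>C (x * y)"
    and mult_scaleC_right: "x * (c *\<^sub>C y) = c *\<^sub>C (x * y)"
    and norm_scaleC: "norm (c *\<^sub>C x) = cmod c * norm x"
    and star_add: "star (x + y) = star x + star y"
    and star_scaleC: "star (c *\<^sub>C x) = cnj c *\<^sub>C star x"
    and star_mult: "star (x * y) = star y * star x"
    and star_star: "star (star x) = x"
    and cstar_identity: "norm (star x * x) = (norm x)\<^sup>2"

text \<open>Linear subspaces and spans are taken over the complex numbers.\<close>

global_interpretation complex_vector: vector_space "scaleC :: complex \<Rightarrow> 'a \<Rightarrow> 'a::cstar_algebra"
  defines csubspace = complex_vector.subspace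
    and cspan = complex_vector.span
proof
  show "1 *\<^sub>C x = x" for x :: 'a
    using scaleR_scaleC[of 1 x] by simp
qed (simp_all add: scaleC_add_right scaleC_add_left scaleC_scaleC)

definition commutator :: "'a::cstar_algebra \<Rightarrow> 'a \<Rightarrow> 'a" where
  "commutator a b = a * b - b * a"

definition commutator_span :: "'a::cstar_algebra set \<Rightarrow> 'a set \<Rightarrow> 'a set" where
  "commutator_span E F = cspan {commutator a b | a b. a \<in> E \<and> b \<in> F}"

definition two_sided_ideal :: "'a::cstar_algebra set \<Rightarrow> bool" where
  "two_sided_ideal I \<longleftrightarrow> csubspace I \<and> (\<forall>a. \<forall>x\<in>I. a * x \<in> I \<and> x * a \<in> I)"

definition ideal_generated :: "'a::cstar_algebra set \<Rightarrow> 'a set" where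
  "ideal_generated S = two_sided_ideal hull S"

definition largest_ideal_in :: "'a::cstar_algebra set \<Rightarrow> 'a set" where
  "largest_ideal_in V = (GREATEST I. two_sided_ideal I \<and> I \<subseteq> V)"

definition ideal_product :: "'a::cstar_algebra set \<Rightarrow> 'a set \<Rightarrow> 'a set" where
  "ideal_product I J = cspan {x * y | x y. x \<in> I \<and> y \<in> J}"

definition semiprime_ideal :: "'a::cstar_algebra set \<Rightarrow> bool" where
  "semiprime_ideal I \<longleftrightarrow> two_sided_ideal I \<and>
     (\<forall>J. two_sided_ideal J \<longrightarrow> ideal_product J J \<subseteq> I \<longrightarrow> J \<subseteq> I)"

definition lie_ideal :: "'a::cstar_algebra set \<Rightarrow> bool" where
  "lie_ideal L \<longleftrightarrow> csubspace L \<and> commutator_span UNIV L \<subseteq> L"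

definition semiprime_lie_ideal :: "'a::cstar_algebra set \<Rightarrow> bool" where
  "semiprime_lie_ideal L \<longleftrightarrow> lie_ideal L \<and>
     (\<forall>K. lie_ideal K \<longrightarrow> commutator_span K K \<subseteq> L \<longrightarrow> K \<subseteq> L)"

definition full_normalizer :: "'a::cstar_algebra set \<Rightarrow> 'a set" where
  "full_normalizer L = {a. commutator_span UNIV {a} \<subseteq> L}"

text \<open>
  The least and greatest ideals in the definitions above exist, so neither definition is
  degenerate.
\<close>

lemma two_sided_ideal_generated: "two_sided_ideal (ideal_generated S)"
  unfolding ideal_generated_def
  by (rule hull_in) (auto simp: two_sided_ideal_def intro!: complex_vector.subspace_Inter)

lemma largest_ideal_in:
  assumes V: "csubspace V"
  shows "two_sided_ideal (largest_ideal_in V)" "largest_ideal_in V \<subseteq> V"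
    and "\<And>J. two_sided_ideal J \<Longrightarrow> J \<subseteq> V \<Longrightarrow> J \<subseteq> largest_ideal_in V"
proof -
  let ?P = "\<lambda>I. two_sided_ideal I \<and> I \<subseteq> V"
  let ?U = "\<Union>{I. ?P I}"
  have "a * x \<in> cspan ?U \<and> x * a \<in> cspan ?U" if "x \<in> cspan ?U" for a x
    using that
  proof (induction rule: complex_vector.span_induct_alt)
    case base
    show ?case by (simp add: complex_vector.span_zero)
  next
    case (step c x y)
    then have "a * x \<in> cspan ?U" "x * a \<in> cspan ?U"
      by (auto simp: two_sided_ideal_def intro!: complex_vector.span_base)
    with step.IH show ?case
      by (simp add: distrib_left distrib_right mult_scaleC_left mult_scaleC_right
          complex_vector.span_add complex_vector.span_scale)
  qed
  then have P: "?P (cspan ?U)"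
    using complex_vector.span_minimal[OF _ V, of ?U]
    by (simp add: two_sided_ideal_def Sup_le_iff)
  have upper: "J \<subseteq> cspan ?U" if "two_sided_ideal J" "J \<subseteq> V" for J
  proof -
    have "J \<subseteq> ?U" using that by blast
    also have "\<dots> \<subseteq> cspan ?U" by (rule complex_vector.span_superset)
    finally show ?thesis .
  qed
  have eq: "largest_ideal_in V = cspan ?U"
    unfolding largest_ideal_in_def
    using P upper by (intro Greatest_equality) simp_all
  show "two_sided_ideal (largest_ideal_in V)" "largest_ideal_in V \<subseteq> V"
    using P by (simp_all only: eq)
  show "J \<subseteq> largest_ideal_in V" if "two_sided_ideal J" "J \<subseteq> V" for J
    unfolding eq by (rule upper[OF that])
qed

end

theory Submission
  imports Defs
begin

text \<open>
  The proof is purely ring-theoretic and rests on two ideas of Herstein.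

  The first is that the full normalizer \<open>T(L)\<close> of a Lie ideal \<open>L\<close> is again a Lie ideal and, by the
  identity \<open>[x, yz] = [xy, z] + [zx, y]\<close>, is closed under multiplication
  (\<open>full_normalizer_mult\<close>); and that a Lie ideal \<open>L\<close> closed under multiplication contains the whole
  two-sided ideal generated by \<open>[L, L]\<close> (\<open>ideal_generated_self_commutators_subset\<close>).
  If \<open>L\<close> is semiprime, then \<open>[T(L), T(L)] \<subseteq> L\<close> gives \<open>L = T(L)\<close>, so this applies to \<open>L\<close> itself and
  shows \<open>[L, L] \<subseteq> I_max\<close>.

  The second is that, modulo a semiprime ideal \<open>J\<close>, a Lie ideal whose commutators are central is
  itself central (\<open>semiprime_lie_ideal_full_normalizer\<close>).  Equivalently, \<open>T(J)\<close> is a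
  semiprime Lie ideal.  Since ideals are Lie ideals, semiprimeness of \<open>L\<close> makes \<open>I_max\<close> a semiprime
  ideal, and \<open>[L, L] \<subseteq> I_max\<close> is thereby upgraded to \<open>[A, L] \<subseteq> I_max\<close>, that is, to
  \<open>I_min \<subseteq> I_max\<close>.

  From this chain of inclusions and the monotonicity of \<open>T\<close> one gets
  \<open>L \<subseteq> T(I_min) \<subseteq> T(I) \<subseteq> T(I_max) \<subseteq> T(L) = L\<close> for every \<open>I\<close> between \<open>I_min\<close> and \<open>I_max\<close>.  Conversely
  \<open>I \<subseteq> T(I)\<close> and \<open>[A, T(I)] \<subseteq> I\<close> hold for every ideal \<open>I\<close>, so \<open>L = T(I)\<close> forces \<open>I\<close> to lie between
  the two.
\<close>

section \<open>Membership criteria\<close>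

lemma commutator_span_subset_iff:
  assumes "csubspace L"
  shows "commutator_span E F \<subseteq> L \<longleftrightarrow> (\<forall>a\<in>E. \<forall>b\<in>F. commutator a b \<in> L)"
proof
  assume "commutator_span E F \<subseteq> L"
  then show "\<forall>a\<in>E. \<forall>b\<in>F. commutator a b \<in> L"
    unfolding commutator_span_def by (blast intro: complex_vector.span_base)
next
  assume "\<forall>a\<in>E. \<forall>b\<in>F. commutator a b \<in> L"
  then show "commutator_span E F \<subseteq> L"
    unfolding commutator_span_def using assms by (intro complex_vector.span_minimal) auto
qed

lemma ideal_product_subset_iff:
  assumes "csubspace L"
  shows "ideal_product I J \<subseteq> L \<longleftrightarrow> (\<forall>a\<in>I. \<forall>b\<in>J. a * b \<in> L)"
proof
  assume "ideal_product I J \<subseteq> L"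
  then show "\<forall>a\<in>I. \<forall>b\<in>J. a * b \<in> L"
    unfolding ideal_product_def by (blast intro: complex_vector.span_base)
next
  assume "\<forall>a\<in>I. \<forall>b\<in>J. a * b \<in> L"
  then show "ideal_product I J \<subseteq> L"
    unfolding ideal_product_def using assms by (intro complex_vector.span_minimal) auto
qed

lemma lie_ideal_iff:
  "lie_ideal L \<longleftrightarrow> csubspace L \<and> (\<forall>a. \<forall>x\<in>L. commutator a x \<in> L)"
  unfolding lie_ideal_def using commutator_span_subset_iff[of L UNIV L] by auto

lemma full_normalizer_iff:
  assumes "csubspace L"
  shows "a \<in> full_normalizer L \<longleftrightarrow> (\<forall>x. commutator x a \<in> L)"
  unfolding full_normalizer_def using commutator_span_subset_iff[OF assms, of UNIV "{a}"] by simp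

lemma two_sided_idealD:
  assumes "two_sided_ideal I"
  shows "csubspace I" and "x \<in> I \<Longrightarrow> a * x \<in> I" and "x \<in> I \<Longrightarrow> x * a \<in> I"
  using assms by (auto simp: two_sided_ideal_def)

lemma csubspace_double_cancel:
  assumes "csubspace L" and "x + x \<in> L"
  shows "x \<in> L"
proof -
  have "x = (1/2) *\<^sub>C (x + x)"
    by (simp flip: scaleC_add_left add: scaleC_add_right)
  then show ?thesis using complex_vector.subspace_scale[OF assms] by metis
qed

lemma commutator_minus_swap: "commutator a b = - commutator b a"
  by (simp add: commutator_def)

lemma two_sided_ideal_imp_lie_ideal:
  assumes "two_sided_ideal I"
  shows "lie_ideal I"
  unfolding lie_ideal_iff commutator_def
  using two_sided_idealD[OF assms] by (auto intro: complex_vector.subspace_diff)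

lemma ideal_generated_subset_iff:
  assumes "two_sided_ideal I"
  shows "ideal_generated S \<subseteq> I \<longleftrightarrow> S \<subseteq> I"
  unfolding ideal_generated_def
  using hull_minimal[of S I two_sided_ideal] hull_subset[of S two_sided_ideal] assms by blast

section \<open>Full normalizers of Lie ideals\<close>

lemma full_normalizer_mono:
  "L \<subseteq> M \<Longrightarrow> full_normalizer L \<subseteq> full_normalizer M"
  unfolding full_normalizer_def by blast

lemma subset_full_normalizer:
  assumes "lie_ideal L"
  shows "L \<subseteq> full_normalizer L"
  using assms full_normalizer_iff[of L] by (auto simp: lie_ideal_iff)

lemma subset_full_normalizer_iff:
  assumes "csubspace M"
  shows "L \<subseteq> full_normalizer M \<longleftrightarrow> commutator_span UNIV L \<subseteq> M"
  using full_normalizer_iff[OF assms] commutator_span_subset_iff[OF assms, of UNIV L] by auto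

lemma csubspace_full_normalizer:
  assumes L: "csubspace L"
  shows "csubspace (full_normalizer L)"
proof (rule complex_vector.subspaceI)
  show "0 \<in> full_normalizer L"
    using complex_vector.subspace_0[OF L] by (simp add: full_normalizer_iff[OF L] commutator_def)
next
  fix x y assume "x \<in> full_normalizer L" "y \<in> full_normalizer L"
  then show "x + y \<in> full_normalizer L"
    using complex_vector.subspace_add[OF L, of "commutator a x" "commutator a y" for a]
    by (simp add: full_normalizer_iff[OF L] commutator_def algebra_simps)
next
  fix c x assume "x \<in> full_normalizer L"
  then show "c *\<^sub>C x \<in> full_normalizer L"
    using complex_vector.subspace_scale[OF L, of "commutator a x" c for a]
    by (simp add: full_normalizer_iff[OF L] commutator_def mult_scaleC_left mult_scaleC_right
        complex_vector.scale_right_diff_distrib)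
qed

lemma lie_ideal_full_normalizer:
  assumes "lie_ideal L"
  shows "lie_ideal (full_normalizer L)"
  using assms csubspace_full_normalizer[of L] full_normalizer_iff[of L]
  by (auto simp: lie_ideal_iff)

text \<open>
  Rotating the factors of a triple product inside a commutator moves the product \<open>x * y\<close> apart, so
  that each of the two resulting commutators has a single normalizing element in it.
\<close>

lemma full_normalizer_mult:
  assumes L: "csubspace L" and x: "x \<in> full_normalizer L" and y: "y \<in> full_normalizer L"
  shows "x * y \<in> full_normalizer L"
proof -
  have "commutator z (x * y) = commutator (z * x) y + commutator (y * z) x" for z
    by (simp add: commutator_def algebra_simps)
  then show ?thesis
    using x y complex_vector.subspace_add[OF L] by (simp add: full_normalizer_iff[OF L])
qed

text \<open>
  For \<open>x, y \<in> L\<close> the Leibniz rule \<open>[x, y * r] = [x, y] * r + y * [x, r]\<close> puts \<open>[x, y] * r\<close> in \<open>L\<close>,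
  because the other two terms are there already.  Hence \<open>L\<close> contains the right ideal generated by
  \<open>[L, L]\<close>; a commutator with an arbitrary element then produces left multiples.
\<close>

lemma ideal_generated_self_commutators_subset:
  assumes L: "lie_ideal L"
    and mult: "\<And>x y. x \<in> L \<Longrightarrow> y \<in> L \<Longrightarrow> x * y \<in> L"
  shows "ideal_generated (commutator_span L L) \<subseteq> L"
proof -
  have sub: "csubspace L" and lie: "\<And>a x. x \<in> L \<Longrightarrow> commutator a x \<in> L"
    using L by (auto simp: lie_ideal_iff)
  \<comment> \<open>The largest ideal in \<open>L\<close>, characterised elementwise.\<close>
  define I where "I = {x. x \<in> L \<and> (\<forall>a. a * x \<in> L) \<and> (\<forall>a. x * a \<in> L) \<and> (\<forall>a b. a * x * b \<in> L)}"
  have "two_sided_ideal I"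
    unfolding two_sided_ideal_def
  proof (intro conjI allI ballI)
    show "csubspace I"
      by (rule complex_vector.subspaceI)
        (auto simp: I_def distrib_left distrib_right mult_scaleC_left mult_scaleC_right
          intro: complex_vector.subspace_0[OF sub] complex_vector.subspace_add[OF sub]
          complex_vector.subspace_scale[OF sub])
  next
    fix a x assume "x \<in> I"
    then have x: "x \<in> L" "c * x \<in> L" "x * c \<in> L" "c * x * e \<in> L" for c e
      by (auto simp: I_def)
    show "a * x \<in> I"
      using x(2,4) by (simp add: I_def flip: mult.assoc)
    have "c * (x * a) \<in> L" "c * (x * a) * e \<in> L" for c e
      using x(4)[of c a] x(4)[of c "a * e"] by (simp_all add: mult.assoc)
    then show "x * a \<in> I"
      using x(3) by (simp add: I_def mult.assoc)
  qed
  moreover have "commutator x y \<in> I" if x: "x \<in> L" and y: "y \<in> L" for x y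
  proof -
    have in_L: "commutator x y \<in> L"
      using lie y by blast
    have right: "commutator x y * r \<in> L" for r
    proof -
      have "commutator x r \<in> L" "commutator x (y * r) \<in> L"
        using lie[OF x] complex_vector.subspace_neg[OF sub] commutator_minus_swap by metis+
      moreover have "commutator x y * r = commutator x (y * r) - y * commutator x r"
        by (simp add: commutator_def algebra_simps)
      ultimately show ?thesis
        using mult[OF y] complex_vector.subspace_diff[OF sub] by simp
    qed
    have left: "s * u \<in> L" if "u \<in> L" "u * s \<in> L" for s u
    proof -
      have "s * u = commutator s u + u * s"
        by (simp add: commutator_def)
      then show ?thesis
        using lie that complex_vector.subspace_add[OF sub] by simp
    qed
    show ?thesis
      using in_L right left by (simp add: I_def mult.assoc)
  qed
  ultimately have "ideal_generated (commutator_span L L) \<subseteq> I"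
    by (simp add: ideal_generated_subset_iff commutator_span_subset_iff two_sided_idealD(1))
  then show ?thesis
    by (auto simp: I_def)
qed

section \<open>Commutators modulo a semiprime ideal\<close>

lemma two_sided_ideal_ideal_product:
  assumes I: "two_sided_ideal I" and J: "two_sided_ideal J"
  shows "two_sided_ideal (ideal_product I J)"
proof -
  let ?S = "{x * y | x y. x \<in> I \<and> y \<in> J}"
  have "a * u \<in> cspan ?S \<and> u * a \<in> cspan ?S" if "u \<in> cspan ?S" for a u
    using that
  proof (induction rule: complex_vector.span_induct_alt)
    case base
    show ?case by (simp add: complex_vector.span_zero)
  next
    case (step c v w)
    then obtain x y where v: "v = x * y" "x \<in> I" "y \<in> J" by blast
    have "a * v = (a * x) * y" "v * a = x * (y * a)"
      by (simp_all add: v mult.assoc)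
    then have "a * v \<in> cspan ?S" "v * a \<in> cspan ?S"
      using v two_sided_idealD[OF I] two_sided_idealD[OF J]
      by (blast intro: complex_vector.span_base)+
    with step.IH show ?case
      by (simp add: distrib_left distrib_right mult_scaleC_left mult_scaleC_right
          complex_vector.span_add complex_vector.span_scale)
  qed
  then show ?thesis
    by (simp add: two_sided_ideal_def ideal_product_def)
qed

text \<open>
  This brings semiprimeness, a condition on ideals, to elements.  As there is no unit, the ideal
  spanned by \<open>A x A\<close> need not contain \<open>x\<close>.  The hypothesis gives only that \<open>A x A\<close> lies in \<open>J\<close>, so
  \<open>x\<close> lies in the ideal \<open>N\<close> of all elements with this property; and \<open>N\<close> is nilpotent modulo \<open>J\<close>,
  since \<open>N * N * N \<subseteq> A * N * A \<subseteq> J\<close>.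
\<close>

lemma semiprime_ideal_sandwich:
  assumes J: "semiprime_ideal J" and x: "\<And>a. x * a * x \<in> J"
  shows "x \<in> J"
proof -
  have I: "two_sided_ideal J"
    and semi: "\<And>K. two_sided_ideal K \<Longrightarrow> ideal_product K K \<subseteq> J \<Longrightarrow> K \<subseteq> J"
    using J by (auto simp: semiprime_ideal_def)
  note sub = two_sided_idealD(1)[OF I] and mulL = two_sided_idealD(2)[OF I]
    and mulR = two_sided_idealD(3)[OF I]
  define S where "S = {a * x * b | a b. True}"
  have S_mult: "a * u \<in> cspan S \<and> u * a \<in> cspan S" if "u \<in> cspan S" for a u
    using that
  proof (induction rule: complex_vector.span_induct_alt)
    case base
    show ?case by (simp add: complex_vector.span_zero)
  next
    case (step c v w)
    then obtain b d where v: "v = b * x * d" by (auto simp: S_def)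
    have "a * v = (a * b) * x * d" "v * a = b * x * (d * a)"
      by (simp_all add: v mult.assoc)
    then have "a * v \<in> cspan S" "v * a \<in> cspan S"
      unfolding S_def by (blast intro: complex_vector.span_base)+
    with step.IH show ?case
      by (simp add: distrib_left distrib_right mult_scaleC_left mult_scaleC_right
          complex_vector.span_add complex_vector.span_scale)
  qed
  have S_ideal: "two_sided_ideal (cspan S)"
    using S_mult by (simp add: two_sided_ideal_def)
  have S_J: "u * v \<in> J" if u: "u \<in> cspan S" and v: "v \<in> S" for u v
    using u
  proof (induction rule: complex_vector.span_induct_alt)
    case base
    show ?case by (simp add: complex_vector.subspace_0[OF sub])
  next
    case (step c s w)
    obtain a b p q where "s = a * x * b" "v = p * x * q"
      using step.hyps v by (auto simp: S_def)
    then have "s * v = a * (x * (b * p) * x) * q"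
      by (simp add: mult.assoc)
    then have "s * v \<in> J"
      using x mulL mulR by simp
    with step.IH show ?case
      by (simp add: distrib_right mult_scaleC_left complex_vector.subspace_add[OF sub]
          complex_vector.subspace_scale[OF sub])
  qed
  have "u * v \<in> J" if u: "u \<in> cspan S" and v: "v \<in> cspan S" for u v
    using v
  proof (induction rule: complex_vector.span_induct_alt)
    case base
    show ?case by (simp add: complex_vector.subspace_0[OF sub])
  next
    case (step c s w)
    with S_J[OF u] show ?case
      by (simp add: distrib_left mult_scaleC_right complex_vector.subspace_add[OF sub]
          complex_vector.subspace_scale[OF sub])
  qed
  then have "ideal_product (cspan S) (cspan S) \<subseteq> J"
    by (simp add: ideal_product_subset_iff[OF sub])
  then have "cspan S \<subseteq> J"
    by (rule semi[OF S_ideal])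
  then have AxA: "a * x * b \<in> J" for a b
    using complex_vector.span_superset[of S] by (auto simp: S_def)

  define N where "N = {u. \<forall>a b. a * u * b \<in> J}"
  have N: "two_sided_ideal N"
    unfolding two_sided_ideal_def
  proof (intro conjI allI ballI)
    show "csubspace N"
      by (rule complex_vector.subspaceI)
        (auto simp: N_def distrib_left distrib_right mult_scaleC_left mult_scaleC_right
          intro: complex_vector.subspace_0[OF sub] complex_vector.subspace_add[OF sub]
          complex_vector.subspace_scale[OF sub])
  next
    fix a u assume "u \<in> N"
    then have u: "c * u * e \<in> J" for c e
      by (auto simp: N_def)
    show "a * u \<in> N"
      using u by (simp add: N_def flip: mult.assoc)
    have "c * (u * a) * e \<in> J" for c e
      using u[of c "a * e"] by (simp add: mult.assoc)
    then show "u * a \<in> N"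
      by (simp add: N_def)
  qed
  let ?NN = "ideal_product N N"
  have NN: "two_sided_ideal ?NN"
    by (rule two_sided_ideal_ideal_product[OF N N])
  have "?NN \<subseteq> N"
    using two_sided_idealD[OF N] by (simp add: ideal_product_subset_iff)
  moreover have "u * v \<in> J" if u: "u \<in> N" and v: "v \<in> ?NN" for u v
    using v unfolding ideal_product_def
  proof (induction rule: complex_vector.span_induct_alt)
    case base
    show ?case by (simp add: complex_vector.subspace_0[OF sub])
  next
    case (step c s w)
    then obtain p q where "s = p * q" "p \<in> N" by blast
    then have "u * s \<in> J"
      by (simp add: N_def flip: mult.assoc)
    with step.IH show ?case
      by (simp add: distrib_left mult_scaleC_right complex_vector.subspace_add[OF sub]
          complex_vector.subspace_scale[OF sub])
  qed
  ultimately have "ideal_product ?NN ?NN \<subseteq> J"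
    by (auto simp: ideal_product_subset_iff[OF sub])
  then have "?NN \<subseteq> J"
    by (rule semi[OF NN])
  then have "N \<subseteq> J"
    by (rule semi[OF N])
  with AxA show ?thesis
    by (auto simp: N_def)
qed

text \<open>
  Write \<open>d\<close> for the inner derivation \<open>[k, _]\<close>.  Since \<open>d\<close> commutes with multiplication by \<open>k\<close>, both
  \<open>d (d x)\<close> and \<open>k * d (d x)\<close> are central modulo \<open>J\<close>, so \<open>d y * d (d x)\<close> vanishes modulo \<open>J\<close>.  This
  kills \<open>d (d x)\<close>.  Then \<open>d (d (x * y))\<close> collapses to \<open>2 * d x * d y\<close>, which in turn kills \<open>d\<close>.
  Each time, the passage from products \<open>u * v\<close> to sandwiches \<open>u * w * v\<close> is the Leibniz rule.
\<close>

lemma commutator_in_semiprime_ideal: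
  assumes J: "semiprime_ideal J"
    and central: "\<And>x y. commutator y (commutator k (commutator k x)) \<in> J"
  shows "commutator k x \<in> J"
proof -
  have I: "two_sided_ideal J"
    using J by (simp add: semiprime_ideal_def)
  note sub = two_sided_idealD(1)[OF I] and mulL = two_sided_idealD(2)[OF I]
    and mulR = two_sided_idealD(3)[OF I]
  define d where "d = commutator k"
  have leibniz: "d (u * v) = d u * v + u * d v" for u v
    by (simp add: d_def commutator_def algebra_simps)
  have d_d_prod: "d y * d (d x) \<in> J" for x y
  proof -
    have "commutator y (d (d (k * x))) \<in> J" "k * commutator y (d (d x)) \<in> J"
      using central mulL by (simp_all add: d_def)
    then have "k * commutator y (d (d x)) - commutator y (d (d (k * x))) \<in> J"
      by (intro complex_vector.subspace_diff[OF sub])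
    moreover have "d y * d (d x) = k * commutator y (d (d x)) - commutator y (d (d (k * x)))"
      by (simp add: d_def commutator_def algebra_simps)
    ultimately show ?thesis by simp
  qed
  have d_d: "d (d x) \<in> J" for x
  proof (rule semiprime_ideal_sandwich[OF J])
    fix w
    have "d (d x * w) * d (d x) - d x * (d w * d (d x)) \<in> J"
      by (intro complex_vector.subspace_diff[OF sub] mulL d_d_prod)
    then show "d (d x) * w * d (d x) \<in> J"
      by (simp add: leibniz algebra_simps)
  qed
  have d_prod: "d x * d y \<in> J" for x y
  proof (rule csubspace_double_cancel[OF sub])
    have "d (d (x * y)) - (d (d x) * y + x * d (d y)) \<in> J"
      by (intro complex_vector.subspace_diff[OF sub] complex_vector.subspace_add[OF sub]
          mulL mulR d_d)
    moreover have "d (d (x * y)) - (d (d x) * y + x * d (d y)) = d x * d y + d x * d y"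
      by (simp add: d_def commutator_def algebra_simps)
    ultimately show "d x * d y + d x * d y \<in> J" by simp
  qed
  have "d x \<in> J"
  proof (rule semiprime_ideal_sandwich[OF J])
    fix w
    have "d x * d (w * x) - d x * d w * x \<in> J"
      by (intro complex_vector.subspace_diff[OF sub] mulR d_prod)
    then show "d x * w * d x \<in> J"
      by (simp add: leibniz algebra_simps)
  qed
  then show ?thesis
    by (simp add: d_def)
qed

text \<open>
  If the commutators of a Lie ideal \<open>K\<close> are central modulo \<open>J\<close>, then so is
  \<open>[k, [k, x]] \<in> [K, K]\<close> for every \<open>k \<in> K\<close>, as \<open>[k, x] \<in> K\<close>.
\<close>

lemma semiprime_lie_ideal_full_normalizer:
  assumes J: "semiprime_ideal J"
  shows "semiprime_lie_ideal (full_normalizer J)"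
proof -
  have I: "two_sided_ideal J"
    using J by (simp add: semiprime_ideal_def)
  note sub = two_sided_idealD(1)[OF I]
  have "K \<subseteq> full_normalizer J"
    if K: "lie_ideal K" and KK: "commutator_span K K \<subseteq> full_normalizer J" for K
  proof
    fix k assume k: "k \<in> K"
    have "commutator y (commutator k (commutator k x)) \<in> J" for x y
    proof -
      have "commutator k x \<in> K"
        using K k commutator_minus_swap[of k x] complex_vector.subspace_neg[of K "commutator x k"]
        by (simp add: lie_ideal_iff)
      then have "commutator k (commutator k x) \<in> full_normalizer J"
        using KK k by (simp add: commutator_span_subset_iff csubspace_full_normalizer[OF sub])
      then show ?thesis
        by (simp add: full_normalizer_iff[OF sub])
    qed
    then have "commutator k x \<in> J" for x
      by (rule commutator_in_semiprime_ideal[OF J])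
    then show "k \<in> full_normalizer J"
      using complex_vector.subspace_neg[OF sub] commutator_minus_swap
      by (metis full_normalizer_iff[OF sub])
  qed
  then show ?thesis
    using lie_ideal_full_normalizer[OF two_sided_ideal_imp_lie_ideal[OF I]]
    by (simp add: semiprime_lie_ideal_def)
qed

section \<open>The ideals attached to a semiprime Lie ideal\<close>

text \<open>
  The full normalizer of \<open>L\<close> is a Lie ideal whose commutators all lie in \<open>L\<close>, so semiprimeness
  absorbs it.
\<close>

lemma semiprime_lie_ideal_eq_full_normalizer:
  assumes "semiprime_lie_ideal L"
  shows "full_normalizer L = L"
proof -
  have L: "lie_ideal L"
    and semi: "\<And>K. lie_ideal K \<Longrightarrow> commutator_span K K \<subseteq> L \<Longrightarrow> K \<subseteq> L"
    using assms by (auto simp: semiprime_lie_ideal_def)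
  have sub: "csubspace L"
    using L by (simp add: lie_ideal_iff)
  have "full_normalizer L \<subseteq> L"
    by (rule semi[OF lie_ideal_full_normalizer[OF L]])
      (auto simp: commutator_span_subset_iff[OF sub] full_normalizer_iff[OF sub])
  with subset_full_normalizer[OF L] show ?thesis by blast
qed

lemma semiprime_ideal_largest_ideal_in:
  assumes "semiprime_lie_ideal L"
  shows "semiprime_ideal (largest_ideal_in L)"
proof -
  have sub: "csubspace L"
    and semi: "\<And>K. lie_ideal K \<Longrightarrow> commutator_span K K \<subseteq> L \<Longrightarrow> K \<subseteq> L"
    using assms by (auto simp: semiprime_lie_ideal_def lie_ideal_iff)
  note M = largest_ideal_in[OF sub]
  have "J \<subseteq> largest_ideal_in L"
    if J: "two_sided_ideal J" and JJ: "ideal_product J J \<subseteq> largest_ideal_in L" for J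
  proof (rule M(3)[OF J])
    have "x * y \<in> L" if "x \<in> J" "y \<in> J" for x y
      using JJ M(2) that by (auto simp: ideal_product_subset_iff[OF two_sided_idealD(1)[OF M(1)]])
    then have "commutator_span J J \<subseteq> L"
      by (simp add: commutator_span_subset_iff[OF sub] commutator_def
          complex_vector.subspace_diff[OF sub])
    then show "J \<subseteq> L"
      by (rule semi[OF two_sided_ideal_imp_lie_ideal[OF J]])
  qed
  with M(1) show ?thesis
    by (simp add: semiprime_ideal_def)
qed

text \<open>
  Being its own full normalizer, \<open>L\<close> is closed under multiplication, so \<open>[L, L]\<close> lies in the largest
  ideal \<open>M\<close> inside \<open>L\<close>.  As \<open>M\<close> is semiprime, so is the Lie ideal \<open>T(M)\<close>, and it contains \<open>L\<close>
  because it contains \<open>[L, L]\<close>.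
\<close>

lemma commutator_span_subset_largest_ideal_in:
  assumes "semiprime_lie_ideal L"
  shows "commutator_span UNIV L \<subseteq> largest_ideal_in L"
proof -
  have L: "lie_ideal L" and sub: "csubspace L"
    using assms by (auto simp: semiprime_lie_ideal_def lie_ideal_iff)
  note M = largest_ideal_in[OF sub]
  have "x * y \<in> L" if "x \<in> L" "y \<in> L" for x y
    using full_normalizer_mult[OF sub, of x y] that
    by (simp add: semiprime_lie_ideal_eq_full_normalizer[OF assms])
  then have "ideal_generated (commutator_span L L) \<subseteq> L"
    by (rule ideal_generated_self_commutators_subset[OF L])
  then have "ideal_generated (commutator_span L L) \<subseteq> largest_ideal_in L"
    by (rule M(3)[OF two_sided_ideal_generated])
  then have "commutator_span L L \<subseteq> largest_ideal_in L"
    by (simp add: ideal_generated_subset_iff[OF M(1)])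
  also have "\<dots> \<subseteq> full_normalizer (largest_ideal_in L)"
    by (rule subset_full_normalizer[OF two_sided_ideal_imp_lie_ideal[OF M(1)]])
  finally have "L \<subseteq> full_normalizer (largest_ideal_in L)"
    using semiprime_lie_ideal_full_normalizer[OF semiprime_ideal_largest_ideal_in[OF assms]] L
    by (simp add: semiprime_lie_ideal_def)
  then show ?thesis
    by (simp add: subset_full_normalizer_iff[OF two_sided_idealD(1)[OF M(1)]])
qed

lemma eq_full_normalizer_iff_between:
  assumes "semiprime_lie_ideal L" and I: "two_sided_ideal I"
  shows "L = full_normalizer I \<longleftrightarrow>
    ideal_generated (commutator_span UNIV L) \<subseteq> I \<and> I \<subseteq> largest_ideal_in L"
proof -
  have sub: "csubspace L"
    using assms(1) by (simp add: semiprime_lie_ideal_def lie_ideal_iff)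
  note M = largest_ideal_in[OF sub]
  have gen: "ideal_generated (commutator_span UNIV L) \<subseteq> I \<longleftrightarrow> L \<subseteq> full_normalizer I"
    by (simp add: ideal_generated_subset_iff[OF I]
        subset_full_normalizer_iff[OF two_sided_idealD(1)[OF I]])
  show ?thesis
  proof
    assume eq: "L = full_normalizer I"
    have "I \<subseteq> L"
      unfolding eq by (rule subset_full_normalizer[OF two_sided_ideal_imp_lie_ideal[OF I]])
    then have "I \<subseteq> largest_ideal_in L"
      by (rule M(3)[OF I])
    with eq gen show "ideal_generated (commutator_span UNIV L) \<subseteq> I \<and> I \<subseteq> largest_ideal_in L"
      by blast
  next
    assume between: "ideal_generated (commutator_span UNIV L) \<subseteq> I \<and> I \<subseteq> largest_ideal_in L"
    then have "I \<subseteq> L"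
      using M(2) by blast
    then have "full_normalizer I \<subseteq> L"
      using full_normalizer_mono semiprime_lie_ideal_eq_full_normalizer[OF assms(1)] by metis
    with between gen show "L = full_normalizer I"
      by blast
  qed
qed

theorem theorem2p8:
  shows "(\<forall>L :: 'a::cstar_algebra set. semiprime_lie_ideal L \<longrightarrow>
      (let I_min = ideal_generated (commutator_span UNIV L);
           I_max = largest_ideal_in L
       in L = full_normalizer I_min \<and>
          L = full_normalizer I_max \<and>
          (\<forall>I. two_sided_ideal I \<longrightarrow>
            (L = full_normalizer I \<longleftrightarrow> I_min \<subseteq> I \<and> I \<subseteq> I_max)) \<and>
          semiprime_ideal I_max)) \<and>
    (\<forall>L :: 'a set. lie_ideal L \<longrightarrow>
      (semiprime_lie_ideal L \<longleftrightarrow> (\<exists>J. semiprime_ideal J \<and> L = full_normalizer J)))"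
proof -
  have main: "L = full_normalizer (ideal_generated (commutator_span UNIV L))"
    "L = full_normalizer (largest_ideal_in L)"
    if L: "semiprime_lie_ideal L" for L :: "'a set"
  proof -
    have "csubspace L"
      using L by (simp add: semiprime_lie_ideal_def lie_ideal_iff)
    then have M: "two_sided_ideal (largest_ideal_in L)"
      by (rule largest_ideal_in(1))
    have "ideal_generated (commutator_span UNIV L) \<subseteq> largest_ideal_in L"
      using commutator_span_subset_largest_ideal_in[OF L]
      by (simp add: ideal_generated_subset_iff[OF M])
    then show "L = full_normalizer (ideal_generated (commutator_span UNIV L))"
      "L = full_normalizer (largest_ideal_in L)"
      using eq_full_normalizer_iff_between[OF L two_sided_ideal_generated]
        eq_full_normalizer_iff_between[OF L M] by blast+
  qed
  show ?thesis
    unfolding Let_def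
  proof (intro conjI allI impI)
    fix L :: "'a set" assume L: "semiprime_lie_ideal L"
    show "L = full_normalizer (ideal_generated (commutator_span UNIV L))"
      "L = full_normalizer (largest_ideal_in L)"
      by (fact main[OF L])+
    show "semiprime_ideal (largest_ideal_in L)"
      by (rule semiprime_ideal_largest_ideal_in[OF L])
    show "L = full_normalizer I \<longleftrightarrow>
        ideal_generated (commutator_span UNIV L) \<subseteq> I \<and> I \<subseteq> largest_ideal_in L"
      if "two_sided_ideal I" for I
      using L that by (rule eq_full_normalizer_iff_between)
  next
    fix L :: "'a set"
    show "semiprime_lie_ideal L \<longleftrightarrow> (\<exists>J. semiprime_ideal J \<and> L = full_normalizer J)"
    proof
      assume L: "semiprime_lie_ideal L"
      then show "\<exists>J. semiprime_ideal J \<and> L = full_normalizer J"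
        using semiprime_ideal_largest_ideal_in[OF L] main(2)[OF L] by (intro exI conjI)
    next
      assume "\<exists>J. semiprime_ideal J \<and> L = full_normalizer J"
      then show "semiprime_lie_ideal L"
        using semiprime_lie_ideal_full_normalizer by auto
    qed
  qed
qed

end
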